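(* There exist numerical constants $c>1$ and $\nu\in[\tfrac1{27},1)$ such that $c$ has property (P) of the context and, with $g(\delta):=c\log(e/\delta)$, the following holds for every $d\ge 1$, every even $N\ge 2$, all $\theta_0,\theta_1\in\mathbb{R}^d$, all $0<\sigma_1^2<\sigma_0^2$ and all positive semidefinite $d\times d$ matrices $\overline\Sigma_0,\overline\Sigma_1$ with trace $d$. Let $Q_1:=\|\theta_1-\theta_0\|$. Let $\tilde\theta_0$ be the empirical mean of $N/2$ i.i.d. samples from $\mathcal N(\theta_0,\sigma_0^2\overline\Sigma_0)$ and let $\tilde\theta_1$ be the empirical mean of $N/2$ i.i.d. samples from $\mathcal N(\theta_1,\sigma_1^2\overline\Sigma_1)$, the two sample sets being independent. For $\delta\in(0,1)$ define $$\hat\theta=\begin{cases}\tilde\theta_0, & \|\tilde\theta_0-\tilde\theta_1\|^2\ge 10\,g(\delta)\,\dfrac{d\sigma_0^2}{N/2},\\[2mm] \tilde\theta_1, & \text{otherwise.}\end{cases}$$ (i) For every $\delta\in(0,1)$, with probability at least $1-\delta$, $$\|\hat\theta-\theta_0\|^2\le \frac{8\,g(\delta/2)}{\nu}\cdot\min\Big\{Q_1^2+\frac{d\sigma_1^2}{N},\ \frac{d\sigma_0^2}{N}\Big\}.$$ (ii) If moreover $Q_1^2\le 4C_\theta^2$ for some constant $C_\theta>0$, then choosing $$\delta=\delta_*:=\Big[\min\Big\{\frac{\sigma_1^2}{\sigma_0^2+\sigma_1^2},\ \frac14,\ \frac{d\sigma_0^2}{8C_\theta^2N}\Big\}\Big]^2$$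 in the definition of $\hat\theta$ gives $$\mathbb{E}\big[\|\hat\theta-\theta_0\|^2\big]\le\frac{28c}{\nu}\log\Big(\frac{2}{\delta_*}\Big)\cdot\min\Big\{Q_1^2+\frac{d\sigma_1^2}{N},\ \frac{d\sigma_0^2}{N}\Big\}.$$
   Context: $\|\cdot\|$ is the Euclidean norm. Property (P) of a constant $c$: for all $d,n\ge1$, $\theta\in\mathbb{R}^d$, $\sigma^2>0$, every positive semidefinite $d\times d$ matrix $\overline\Sigma$ with $\mathrm{Tr}[\overline\Sigma]=d$, and every $\delta\in(0,1)$, the empirical mean $\bar\theta(n)$ of $n$ i.i.d. samples from $\mathcal N(\theta,\sigma^2\overline\Sigma)$ satisfies $\|\bar\theta(n)-\theta\|^2\le c\log(e/\delta)\cdot\frac{d\sigma^2}{n}$ with probability at least $1-\delta$. *)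

theory Defs
  imports "HOL-Probability.Probability"
begin

text \<open>
  The constants of the theorem may not depend on the dimension, so the dimension must be quantified
  inside the formula. A vector of dimension \<open>d\<close> is therefore a function \<open>nat \<Rightarrow> real\<close> of which only
  the values at \<open>i < d\<close> matter, and a \<open>d \<times> d\<close> matrix is a function \<open>nat \<Rightarrow> nat \<Rightarrow> real\<close>.
\<close>

definition dist_d :: "nat \<Rightarrow> (nat \<Rightarrow> real) \<Rightarrow> (nat \<Rightarrow> real) \<Rightarrow> real" where
  "dist_d d x y = L2_set (\<lambda>i. x i - y i) {..<d}"

definition psd :: "nat \<Rightarrow> (nat \<Rightarrow> nat \<Rightarrow> real) \<Rightarrow> bool" where
  "psd d S \<longleftrightarrow> (\<forall>i<d. \<forall>j<d. S i j = S j i) \<and>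
     (\<forall>a :: nat \<Rightarrow> real. 0 \<le> (\<Sum>i<d. \<Sum>j<d. a i * S i j * a j))"

definition trace_d :: "nat \<Rightarrow> (nat \<Rightarrow> nat \<Rightarrow> real) \<Rightarrow> real" where
  "trace_d d S = (\<Sum>i<d. S i i)"

text \<open>The second argument is the variance; variance 0 gives the point mass at the mean.\<close>

definition normal_law :: "real \<Rightarrow> real \<Rightarrow> real measure" where
  "normal_law m v =
     (if v = 0 then return borel m else density lborel (\<lambda>x. ennreal (normal_density m (sqrt v) x)))"

text \<open>\<open>\<mu>\<close> is the law \<open>N(\<theta>, S)\<close> on \<open>\<real>\<^sup>d\<close>: every linear functional is univariate normal with the
  mean and variance prescribed by \<open>\<theta>\<close> and \<open>S\<close>. The matrix \<open>S\<close> may be singular, so a definition by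
  a density would be too narrow.\<close>

definition is_mvn :: "nat \<Rightarrow> (nat \<Rightarrow> real) \<Rightarrow> (nat \<Rightarrow> nat \<Rightarrow> real) \<Rightarrow> (nat \<Rightarrow> real) measure \<Rightarrow> bool" where
  "is_mvn d \<theta> S \<mu> \<longleftrightarrow>
     prob_space \<mu> \<and> sets \<mu> = sets (\<Pi>\<^sub>M i\<in>{..<d}. (borel :: real measure)) \<and>
     (\<forall>a :: nat \<Rightarrow> real. distr \<mu> borel (\<lambda>x. \<Sum>i<d. a i * x i) =
        normal_law (\<Sum>i<d. a i * \<theta> i) (\<Sum>i<d. \<Sum>j<d. a i * S i j * a j))"

text \<open>The joint law of \<open>n\<close> i.i.d. samples from \<open>\<mu>\<close>; the \<open>j\<close>-th sample is the \<open>j\<close>-th coordinate.\<close>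

definition iid_samples :: "nat \<Rightarrow> (nat \<Rightarrow> real) measure \<Rightarrow> (nat \<Rightarrow> nat \<Rightarrow> real) measure" where
  "iid_samples n \<mu> = (\<Pi>\<^sub>M j\<in>{..<n}. \<mu>)"

definition emp_mean :: "nat \<Rightarrow> (nat \<Rightarrow> nat \<Rightarrow> real) \<Rightarrow> nat \<Rightarrow> real" where
  "emp_mean n X = (\<lambda>i. (\<Sum>j<n. X j i) / real n)"

definition g_fun :: "real \<Rightarrow> real \<Rightarrow> real" where
  "g_fun c \<delta> = c * ln (exp 1 / \<delta>)"

definition property_P :: "real \<Rightarrow> bool" where
  "property_P c \<longleftrightarrow>
     (\<forall>(d::nat) (n::nat) (\<theta> :: nat \<Rightarrow> real) (v::real) (S :: nat \<Rightarrow> nat \<Rightarrow> real) (\<delta>::real)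
        (\<mu> :: (nat \<Rightarrow> real) measure).
        1 \<le> d \<longrightarrow> 1 \<le> n \<longrightarrow> 0 < v \<longrightarrow> psd d S \<longrightarrow> trace_d d S = real d \<longrightarrow> 0 < \<delta> \<longrightarrow> \<delta> < 1 \<longrightarrow>
        is_mvn d \<theta> (\<lambda>i j. v * S i j) \<mu> \<longrightarrow>
        \<P>(X in iid_samples n \<mu>.
            (dist_d d (emp_mean n X) \<theta>)\<^sup>2 \<le> c * ln (exp 1 / \<delta>) * (real d * v / real n)) \<ge> 1 - \<delta>)"

text \<open>Below, \<open>v0\<close> and \<open>v1\<close> stand for the variances \<open>\<sigma>\<^sub>0\<^sup>2\<close> and \<open>\<sigma>\<^sub>1\<^sup>2\<close>. The pair consists of the
  two sample sets, each of size \<open>N / 2\<close>; \<open>N\<close> is even in all uses, so \<open>N div 2\<close> is exact.\<close>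

definition theta_hat ::
  "real \<Rightarrow> nat \<Rightarrow> nat \<Rightarrow> real \<Rightarrow> real \<Rightarrow> (nat \<Rightarrow> nat \<Rightarrow> real) \<times> (nat \<Rightarrow> nat \<Rightarrow> real) \<Rightarrow> nat \<Rightarrow> real" where
  "theta_hat c d N v0 \<delta> XY =
     (let t0 = emp_mean (N div 2) (fst XY); t1 = emp_mean (N div 2) (snd XY) in
      if (dist_d d t0 t1)\<^sup>2 \<ge> 10 * g_fun c \<delta> * (real d * v0 / (real N / 2)) then t0 else t1)"

definition delta_star :: "nat \<Rightarrow> nat \<Rightarrow> real \<Rightarrow> real \<Rightarrow> real \<Rightarrow> real" where
  "delta_star d N v0 v1 C =
     (min (v1 / (v0 + v1)) (min (1 / 4) (real d * v0 / (8 * C\<^sup>2 * real N))))\<^sup>2"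

end

theory Submission
  imports Defs
begin

text \<open>
  The constants are \<open>c = 4\<close> and \<open>\<nu> = 1 / 27\<close>. Without diagonalising the covariance, the squared error of an
  empirical mean, divided by \<open>d \<sigma>\<^sup>2 / n\<close>, is a convex combination of \<open>\<chi>\<^sup>2\<close> variables with one degree of
  freedom; hence a quarter of it has exponential moment at most \<open>sqrt 2\<close>, and Markov's inequality gives
  property (P). When both empirical means satisfy their tail bound at level \<open>\<delta> / 2\<close>, the triangle
  inequality gives (i): if the first mean is selected, the bias \<open>Q\<^sub>1\<close> is at least of the order of the
  standard deviation of the first mean, and otherwise the two means are close. For (ii), the failure
  event has probability at most \<open>\<delta>\<^sub>*\<close>, and \<open>sqrt \<delta>\<^sub>*\<close> times the crude size of the error is of the order of
  the minimum in the bound.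
\<close>

section \<open>Sub-exponential tails of the empirical mean\<close>

text \<open>The factor halves the rate of the Gaussian exponent, so the variance doubles and
  \<open>sqrt 2\<close> is the ratio of the normalising constants. For \<open>x / \<sigma>\<close>
  the rate is 1/4, half of the critical rate 1/2; this choice leads to \<open>c = 4\<close>.\<close>

lemma has_bochner_integral_normal_exp_square:
  fixes \<sigma> :: real
  assumes [arith]: "0 < \<sigma>"
  shows "has_bochner_integral lborel (\<lambda>x. normal_density 0 \<sigma> x * exp (x\<^sup>2 / (4 * \<sigma>\<^sup>2))) (sqrt 2)"
proof -
  have eq: "normal_density 0 \<sigma> x * exp (x\<^sup>2 / (4 * \<sigma>\<^sup>2)) = sqrt 2 * normal_density 0 (sqrt 2 * \<sigma>) x" for x
  proof -
    have "exp (- x\<^sup>2 / (2 * \<sigma>\<^sup>2)) * exp (x\<^sup>2 / (4 * \<sigma>\<^sup>2)) = exp (- x\<^sup>2 / (2 * (sqrt 2 * \<sigma>)\<^sup>2))"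
      unfolding exp_add[symmetric] by (rule arg_cong[where f=exp]) (simp add: power_mult_distrib field_simps)
    then show ?thesis
      by (simp add: normal_density_def power_mult_distrib real_sqrt_mult field_simps)
  qed
  have "has_bochner_integral lborel (normal_density 0 (sqrt 2 * \<sigma>)) 1"
    using integrable_normal_density[of "sqrt 2 * \<sigma>" 0] integral_normal_density[of "sqrt 2 * \<sigma>" 0]
    by (simp add: has_bochner_integral_iff)
  from has_bochner_integral_mult_right[OF this, of "sqrt 2"] show ?thesis
    by (simp add: eq)
qed

lemma distr_pair_snd:
  assumes "prob_space M" "prob_space N"
  shows "distr (M \<Otimes>\<^sub>M N) N snd = N"
proof -
  interpret M: prob_space M by fact
  interpret N: prob_space N by fact
  show ?thesis
  proof (intro measure_eqI)
    fix A assume A: "A \<in> sets (distr (M \<Otimes>\<^sub>M N) N snd)"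
    from A have "emeasure (distr (M \<Otimes>\<^sub>M N) N snd) A = emeasure (M \<Otimes>\<^sub>M N) (space M \<times> A)"
      by (auto simp add: emeasure_distr space_pair_measure dest: sets.sets_into_space
          intro!: arg_cong2[where f=emeasure])
    with A show "emeasure (distr (M \<Otimes>\<^sub>M N) N snd) A = emeasure N A"
      by (simp add: N.emeasure_pair_measure_Times M.emeasure_space_1)
  qed simp
qed

text \<open>Independence means that the joint law is the product of the marginals. Here the joint
  law is the product measure itself, and each marginal is \<open>\<mu>\<close>.\<close>

lemma indep_vars_PiM_coordinates:
  assumes "prob_space \<mu>" "I \<noteq> {}"
  shows "prob_space.indep_vars (\<Pi>\<^sub>M j\<in>I. \<mu>) (\<lambda>_. \<mu>) (\<lambda>j \<omega>. \<omega> j) I"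
proof -
  interpret P: prob_space "\<Pi>\<^sub>M j\<in>I. \<mu>"
    using assms(1) by (intro prob_space_PiM)
  have 1: "distr (\<Pi>\<^sub>M j\<in>I. \<mu>) (\<Pi>\<^sub>M j\<in>I. \<mu>) (\<lambda>\<omega>. \<lambda>j\<in>I. \<omega> j) = (\<Pi>\<^sub>M j\<in>I. \<mu>)"
  proof -
    have "distr (\<Pi>\<^sub>M j\<in>I. \<mu>) (\<Pi>\<^sub>M j\<in>I. \<mu>) (\<lambda>\<omega>. \<lambda>j\<in>I. \<omega> j) = distr (\<Pi>\<^sub>M j\<in>I. \<mu>) (\<Pi>\<^sub>M j\<in>I. \<mu>) (\<lambda>\<omega>. \<omega>)"
      by (intro distr_cong) (auto simp: space_PiM)
    then show ?thesis by (simp add: distr_id2)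
  qed
  have 2: "(\<Pi>\<^sub>M j\<in>I. distr (\<Pi>\<^sub>M j\<in>I. \<mu>) \<mu> (\<lambda>\<omega>. \<omega> j)) = (\<Pi>\<^sub>M j\<in>I. \<mu>)"
    by (intro PiM_cong refl distr_PiM_component[where M="\<lambda>_. \<mu>"] assms)
  show ?thesis
    by (subst P.indep_vars_iff_distr_eq_PiM') (auto simp: assms 1 2)
qed

section \<open>The law of one coordinate of the empirical mean\<close>

locale gaussian_samples =
  fixes d n :: nat and \<theta> :: "nat \<Rightarrow> real" and v :: real and S :: "nat \<Rightarrow> nat \<Rightarrow> real"
    and \<mu> :: "(nat \<Rightarrow> real) measure"
  assumes d: "1 \<le> d" and n: "1 \<le> n" and v: "0 < v" and S: "psd d S" "trace_d d S = real d"
    and mvn: "is_mvn d \<theta> (\<lambda>i j. v * S i j) \<mu>"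
begin

sublocale \<mu>: prob_space \<mu>
  using mvn by (simp add: is_mvn_def)

sublocale prob_space "iid_samples n \<mu>"
  unfolding iid_samples_def by (intro prob_space_PiM) (rule \<mu>.prob_space_axioms)

lemma coordinate_measurable [measurable]: "i < d \<Longrightarrow> (\<lambda>x. x i) \<in> borel_measurable \<mu>"
  using mvn by (subst measurable_cong_sets[where N'=borel]) (auto simp: is_mvn_def)

lemma sample_measurable [measurable]: "j < n \<Longrightarrow> (\<lambda>X. X j) \<in> measurable (iid_samples n \<mu>) \<mu>"
  unfolding iid_samples_def by measurable

lemma emp_mean_measurable [measurable]:
  assumes "i < d" shows "(\<lambda>X. emp_mean n X i) \<in> borel_measurable (iid_samples n \<mu>)"
proof -
  have "(\<lambda>X. X j i) \<in> borel_measurable (iid_samples n \<mu>)" if "j < n" for j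
    using measurable_compose[OF sample_measurable[OF that] coordinate_measurable[OF assms]] .
  then show ?thesis
    unfolding emp_mean_def by (intro borel_measurable_divide borel_measurable_sum) auto
qed

lemma diag_nonneg:
  assumes "i < d" shows "0 \<le> S i i"
proof -
  \<comment> \<open>The quadratic form is tested on the \<open>i\<close>-th unit vector, written
    with \<open>of_bool\<close>.\<close>
  have "0 \<le> (\<Sum>k<d. \<Sum>j<d. of_bool (k = i) * S k j * of_bool (j = i))"
    using S(1) unfolding psd_def by (elim conjE allE[of _ "\<lambda>k. of_bool (k = i)"])
  also have "\<dots> = (\<Sum>k<d. if k = i then (\<Sum>j<d. if j = i then S k j else 0) else 0)"
    by (intro sum.cong refl) (auto intro!: sum.cong)
  also have "\<dots> = S i i"
    using assms by simp
  finally show ?thesis .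
qed

lemma coordinate_law:
  assumes "i < d" shows "distr \<mu> borel (\<lambda>x. x i) = normal_law (\<theta> i) (v * S i i)"
proof -
  have *: "distr \<mu> borel (\<lambda>x. \<Sum>k<d. of_bool (k = i) * x k) =
     normal_law (\<Sum>k<d. of_bool (k = i) * \<theta> k)
       (\<Sum>k<d. \<Sum>j<d. of_bool (k = i) * (v * S k j) * of_bool (j = i))"
    using mvn unfolding is_mvn_def by (elim conjE allE[of _ "\<lambda>k. of_bool (k = i)"])
  have a: "(\<Sum>k<d. of_bool (k = i) * y k) = y i" for y :: "nat \<Rightarrow> real"
  proof -
    have "(\<Sum>k<d. of_bool (k = i) * y k) = (\<Sum>k<d. if k = i then y k else 0)"
      by (intro sum.cong) auto
    then show ?thesis using assms by simp
  qed
  have b: "(\<Sum>k<d. \<Sum>j<d. of_bool (k = i) * (v * S k j) * of_bool (j = i)) = v * S i i"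
  proof -
    have "(\<Sum>k<d. \<Sum>j<d. of_bool (k = i) * (v * S k j) * of_bool (j = i)) =
      (\<Sum>k<d. of_bool (k = i) * (\<Sum>j<d. of_bool (j = i) * (v * S k j)))"
      by (auto simp: sum_distrib_left mult_ac intro!: sum.cong)
    then show ?thesis by (simp only: a)
  qed
  show ?thesis using * unfolding a b .
qed

definition sd :: "nat \<Rightarrow> real" where
  "sd i = sqrt (v * S i i / real n)"

text \<open>With zero variance the coordinate is a point mass, which has no density, so this case is
  kept apart: almost surely all \<open>n\<close> samples share the value
  \<open>\<theta> i\<close>.\<close>

lemma emp_mean_degenerate:
  assumes "i < d" "S i i = 0"
  shows "AE X in iid_samples n \<mu>. emp_mean n X i = \<theta> i"
proof -
  have [measurable]: "(\<lambda>x. x i) \<in> borel_measurable \<mu>"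
    by (rule coordinate_measurable) fact
  have "AE y in distr \<mu> borel (\<lambda>x. x i). y = \<theta> i"
  proof -
    have "normal_law (\<theta> i) (v * S i i) = return borel (\<theta> i)"
      by (simp add: normal_law_def assms)
    then show ?thesis
      unfolding coordinate_law[OF assms(1)]
      by (simp only:) (subst AE_return, auto)
  qed
  then have "AE x in \<mu>. x i = \<theta> i"
    by (subst (asm) AE_distr_iff) auto
  then have "AE X in iid_samples n \<mu>. \<forall>j<n. X j i = \<theta> i"
    unfolding iid_samples_def
    by (subst AE_all_countable | auto intro!: AE_PiM_component \<mu>.prob_space_axioms AE_impI)+
  then show ?thesis
    by eventually_elim (use n in \<open>simp add: emp_mean_def\<close>)
qed

text \<open>For a fixed coordinate, the \<open>n\<close> samples are independent univariate normals.
  Their sum is normal with \<open>n\<close> times the mean and variance, and an affine map centres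
  and rescales it.\<close>

lemma emp_mean_distributed:
  assumes "i < d" "S i i \<noteq> 0"
  shows "distributed (iid_samples n \<mu>) lborel (\<lambda>X. emp_mean n X i - \<theta> i) (normal_density 0 (sd i))"
proof -
  have [measurable]: "(\<lambda>x. x i) \<in> borel_measurable \<mu>"
    by (rule coordinate_measurable) fact
  have pos: "0 < S i i"
    using diag_nonneg[OF assms(1)] assms(2) by simp
  have n': "{..<n} \<noteq> {}" using n by (auto simp: lessThan_empty_iff)
  have indep: "indep_vars (\<lambda>_. borel) (\<lambda>j X. X j i) {..<n}"
  proof (rule indep_vars_compose2[where X="\<lambda>j X. X j" and Y="\<lambda>j x. x i"])
    show "indep_vars (\<lambda>_. \<mu>) (\<lambda>j X. X j) {..<n}"
      unfolding iid_samples_def using indep_vars_PiM_coordinates[OF \<mu>.prob_space_axioms n'] .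
  qed measurable
  have law: "distributed (iid_samples n \<mu>) lborel (\<lambda>X. X j i) (normal_density (\<theta> i) (sqrt (v * S i i)))"
    if "j \<in> {..<n}" for j
  proof -
    have [measurable]: "(\<lambda>X. X j) \<in> measurable (iid_samples n \<mu>) \<mu>"
      using that by (intro sample_measurable) simp
    have "distr (iid_samples n \<mu>) lborel (\<lambda>X. X j i) = distr (iid_samples n \<mu>) borel (\<lambda>X. X j i)"
      by (intro distr_cong) auto
    also have "\<dots> = distr (distr (iid_samples n \<mu>) \<mu> (\<lambda>X. X j)) borel (\<lambda>x. x i)"
      by (subst distr_distr) (auto simp: comp_def)
    also have "distr (iid_samples n \<mu>) \<mu> (\<lambda>X. X j) = \<mu>"
      unfolding iid_samples_def using that
      by (intro distr_PiM_component[where M="\<lambda>_. \<mu>"] \<mu>.prob_space_axioms)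
    finally show ?thesis
      unfolding distributed_def coordinate_law[OF assms(1)]
      using pos v by (auto simp: normal_law_def)
  qed
  have "distributed (iid_samples n \<mu>) lborel (\<lambda>X. \<Sum>j<n. X j i)
      (normal_density (\<Sum>j<n. \<theta> i) (sqrt (\<Sum>j<n. (sqrt (v * S i i))\<^sup>2)))"
    by (rule sum_indep_normal[OF _ n' indep _ law]) (use pos v in auto)
  then have "distributed (iid_samples n \<mu>) lborel (\<lambda>X. \<Sum>j<n. X j i)
      (normal_density (real n * \<theta> i) (sqrt (real n * (v * S i i))))"
    using pos v by simp
  from normal_density_affine[OF this, of "1 / real n" "- \<theta> i"]
  have "distributed (iid_samples n \<mu>) lborel (\<lambda>X. - \<theta> i + 1 / real n * (\<Sum>j<n. X j i))
      (normal_density 0 (1 / real n * sqrt (real n * (v * S i i))))"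
    using pos v n by simp
  moreover have "1 / real n * sqrt (real n * (v * S i i)) = sd i"
    using n by (simp add: sd_def real_sqrt_mult real_sqrt_divide real_div_sqrt field_simps)
  ultimately show ?thesis
    by (simp add: emp_mean_def)
qed

lemma expectation_exp_coordinate:
  assumes "i < d"
  shows "integrable (iid_samples n \<mu>) (\<lambda>X. exp ((emp_mean n X i - \<theta> i)\<^sup>2 / (4 * (sd i)\<^sup>2)))"
    and "expectation (\<lambda>X. exp ((emp_mean n X i - \<theta> i)\<^sup>2 / (4 * (sd i)\<^sup>2))) \<le> sqrt 2"
proof -
  have "integrable (iid_samples n \<mu>) (\<lambda>X. exp ((emp_mean n X i - \<theta> i)\<^sup>2 / (4 * (sd i)\<^sup>2))) \<and>
    expectation (\<lambda>X. exp ((emp_mean n X i - \<theta> i)\<^sup>2 / (4 * (sd i)\<^sup>2))) \<le> sqrt 2"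
  proof (cases "S i i = 0")
    case True
    \<comment> \<open>Here \<open>sd i = 0\<close>, so the quotient is 0 by the convention for
      division by zero; the exponential is 1, which is below \<open>sqrt 2\<close>.\<close>
    then show ?thesis by (simp add: sd_def prob_space)
  next
    case False
    then have "0 < sd i"
      using diag_nonneg[OF assms] v n by (simp add: sd_def)
    note I = has_bochner_integral_normal_exp_square[OF this]
    note D = emp_mean_distributed[OF assms False]
    show ?thesis
      using I distributed_integrable[OF D, of "\<lambda>x. exp (x\<^sup>2 / (4 * (sd i)\<^sup>2))"]
        distributed_integral[OF D, of "\<lambda>x. exp (x\<^sup>2 / (4 * (sd i)\<^sup>2))"]
      by (simp add: has_bochner_integral_iff)
  qed
  then show "integrable (iid_samples n \<mu>) (\<lambda>X. exp ((emp_mean n X i - \<theta> i)\<^sup>2 / (4 * (sd i)\<^sup>2)))"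
    and "expectation (\<lambda>X. exp ((emp_mean n X i - \<theta> i)\<^sup>2 / (4 * (sd i)\<^sup>2))) \<le> sqrt 2"
    by auto
qed

section \<open>The squared error in units of its expectation \<open>d * v / n\<close>, and its
  exponential moment\<close>

definition nsq_error :: "(nat \<Rightarrow> nat \<Rightarrow> real) \<Rightarrow> real" where
  "nsq_error X = (dist_d d (emp_mean n X) \<theta>)\<^sup>2 / (real d * v / real n)"

lemma nsq_error_nonneg: "0 \<le> nsq_error X"
  using v by (simp add: nsq_error_def)

lemma dist_eq_nsq_error: "(dist_d d (emp_mean n X) \<theta>)\<^sup>2 = nsq_error X * (real d * v / real n)"
  using v n d by (simp add: nsq_error_def)

lemma dist_emp_mean_measurable [measurable]:
  "(\<lambda>X. dist_d d (emp_mean n X) \<tau>) \<in> borel_measurable (iid_samples n \<mu>)"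
proof -
  have [measurable]: "(\<lambda>X. \<Sum>i<d. (emp_mean n X i - \<tau> i)\<^sup>2) \<in> borel_measurable (iid_samples n \<mu>)"
    by (intro borel_measurable_sum borel_measurable_power borel_measurable_diff
        emp_mean_measurable borel_measurable_const) auto
  show ?thesis
    unfolding dist_d_def L2_set_def by measurable
qed

lemma nsq_error_measurable [measurable]: "nsq_error \<in> borel_measurable (iid_samples n \<mu>)"
  unfolding nsq_error_def by measurable

text \<open>The normalised squared error is a convex combination, with weights \<open>S i i / d\<close>, of (dependent)
  \<open>\<chi>\<^sup>2\<close> variables with one degree of freedom, so Jensen's inequality reduces its exponential moment
  to that of a single one. A zero \<open>sd i\<close> makes the corresponding quotient \<open>0\<close>.\<close>

lemma exp_nsq_error_le:
  "AE X in iid_samples n \<mu>.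
     exp (nsq_error X / 4) \<le> (\<Sum>i<d. S i i / real d * exp ((emp_mean n X i - \<theta> i)\<^sup>2 / (4 * (sd i)\<^sup>2)))"
proof -
  have "AE X in iid_samples n \<mu>. \<forall>i<d. S i i = 0 \<longrightarrow> emp_mean n X i = \<theta> i"
    using emp_mean_degenerate by (auto simp: AE_all_countable intro!: AE_impI)
  then show ?thesis
  proof eventually_elim
    case (elim X)
    let ?y = "\<lambda>i. (emp_mean n X i - \<theta> i)\<^sup>2 / (4 * (sd i)\<^sup>2)"
    have "nsq_error X / 4 = (\<Sum>i<d. (emp_mean n X i - \<theta> i)\<^sup>2 / (real d * v / real n) / 4)"
      by (simp add: nsq_error_def dist_d_def L2_set_def sum_nonneg sum_divide_distrib[symmetric]
            del: divide_divide_eq_left divide_divide_eq_right)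
    also have "\<dots> = (\<Sum>i<d. S i i / real d * ?y i)"
    proof (intro sum.cong refl)
      fix i assume "i \<in> {..<d}"
      then have i: "i < d" by simp
      show "(emp_mean n X i - \<theta> i)\<^sup>2 / (real d * v / real n) / 4 = S i i / real d * ?y i"
      proof (cases "S i i = 0")
        case True
        with elim i show ?thesis by simp
      next
        case False
        then have "0 < S i i" using diag_nonneg[OF i] by simp
        moreover from this have sd2: "(sd i)\<^sup>2 = v * S i i / real n"
          using v by (auto simp: sd_def)
        ultimately show ?thesis
          unfolding sd2 using v n d by (simp add: field_simps)
      qed
    qed
    finally have "nsq_error X / 4 = (\<Sum>i<d. (S i i / real d) *\<^sub>R ?y i)" by simp
    moreover have "exp (\<Sum>i<d. (S i i / real d) *\<^sub>R ?y i) \<le> (\<Sum>i<d. S i i / real d * exp (?y i))"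
    proof (rule convex_on_sum[OF _ _ exp_convex])
      show "{..<d} \<noteq> {}" using d by (auto simp: lessThan_empty_iff)
      \<comment> \<open>The normalisation of the trace to \<open>d\<close> is what makes the
        diagonal entries, divided by \<open>d\<close>, convex weights.\<close>
      show "(\<Sum>i<d. S i i / real d) = 1"
        using S(2) d by (simp add: trace_d_def sum_divide_distrib[symmetric])
    qed (auto simp: diag_nonneg)
    ultimately show ?case by simp
  qed
qed

lemma integrable_exp_nsq_error: "integrable (iid_samples n \<mu>) (\<lambda>X. exp (nsq_error X / 4))"
proof (rule Bochner_Integration.integrable_bound)
  show "integrable (iid_samples n \<mu>)
    (\<lambda>X. \<Sum>i<d. S i i / real d * exp ((emp_mean n X i - \<theta> i)\<^sup>2 / (4 * (sd i)\<^sup>2)))"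
    by (intro Bochner_Integration.integrable_sum integrable_mult_right expectation_exp_coordinate) auto
  show "AE X in iid_samples n \<mu>. norm (exp (nsq_error X / 4)) \<le>
     norm (\<Sum>i<d. S i i / real d * exp ((emp_mean n X i - \<theta> i)\<^sup>2 / (4 * (sd i)\<^sup>2)))"
    using exp_nsq_error_le by eventually_elim auto
qed measurable

lemma expectation_exp_nsq_error: "expectation (\<lambda>X. exp (nsq_error X / 4)) \<le> sqrt 2"
proof -
  let ?e = "\<lambda>i X. exp ((emp_mean n X i - \<theta> i)\<^sup>2 / (4 * (sd i)\<^sup>2))"
  have "expectation (\<lambda>X. exp (nsq_error X / 4)) \<le> expectation (\<lambda>X. \<Sum>i<d. S i i / real d * ?e i X)"
    by (intro integral_mono_AE exp_nsq_error_le integrable_exp_nsq_error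
        Bochner_Integration.integrable_sum integrable_mult_right expectation_exp_coordinate) auto
  also have "\<dots> = (\<Sum>i<d. S i i / real d * expectation (?e i))"
    by (subst Bochner_Integration.integral_sum)
       (auto intro!: integrable_mult_right expectation_exp_coordinate)
  also have "\<dots> \<le> (\<Sum>i<d. S i i / real d * sqrt 2)"
    by (intro sum_mono mult_left_mono expectation_exp_coordinate) (auto simp: diag_nonneg)
  also have "\<dots> = sqrt 2"
    using S(2) d by (simp add: trace_d_def sum_divide_distrib[symmetric] sum_distrib_right[symmetric])
  finally show ?thesis .
qed

end

text \<open>Markov's inequality for \<open>exp (Y / 4)\<close> at level
  \<open>exp 1 / \<delta>\<close>, which is \<open>exp (g_fun 4 \<delta> / 4)\<close>. The variable
  is left general so that the bound serves both a single sample and the product space of two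
  samples.\<close>

lemma (in prob_space) exp_moment_tail:
  assumes [measurable]: "Y \<in> borel_measurable M"
    and int: "integrable M (\<lambda>x. exp (Y x / 4))" and le: "expectation (\<lambda>x. exp (Y x / 4)) \<le> sqrt 2"
    and \<delta>: "0 < \<delta>"
  shows "prob {x \<in> space M. g_fun 4 \<delta> < Y x} \<le> \<delta>"
proof -
  have "prob {x \<in> space M. g_fun 4 \<delta> < Y x} \<le> prob {x \<in> space M. exp 1 / \<delta> \<le> exp (Y x / 4)}"
  proof (rule finite_measure_mono)
    have "exp 1 / \<delta> \<le> exp (Y x / 4)" if "g_fun 4 \<delta> < Y x" for x
    proof -
      have "exp (ln (exp 1 / \<delta>)) \<le> exp (Y x / 4)"
        using that by (simp add: g_fun_def)
      then show ?thesis using \<delta> by simp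
    qed
    then show "{x \<in> space M. g_fun 4 \<delta> < Y x} \<subseteq> {x \<in> space M. exp 1 / \<delta> \<le> exp (Y x / 4)}"
      by auto
  qed measurable
  also have "\<dots> \<le> expectation (\<lambda>x. exp (Y x / 4)) / (exp 1 / \<delta>)"
    using \<delta> by (intro integral_Markov_inequality_measure[where A="{}"] int) auto
  \<comment> \<open>The \<open>e\<close> inside the logarithm of \<open>g_fun\<close> absorbs the
    moment bound \<open>sqrt 2\<close>.\<close>
  also have "\<dots> \<le> exp 1 / (exp 1 / \<delta>)"
  proof (intro divide_right_mono order_trans[OF le])
    have "sqrt 2 \<le> 2" by (intro real_le_lsqrt) auto
    also have "2 \<le> exp (1::real)" using exp_ge_add_one_self[of 1] by simp
    finally show "sqrt 2 \<le> exp 1" .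
  qed (use \<delta> in auto)
  finally show ?thesis using \<delta> by simp
qed

lemma (in prob_space) prob_compl_ge:
  assumes [measurable]: "Measurable.pred M P" and "prob {x \<in> space M. \<not> P x} \<le> \<delta>"
  shows "1 - \<delta> \<le> prob {x \<in> space M. P x}"
  using prob_neg[of P] assms(2) by simp

lemma property_P_4: "property_P 4"
  unfolding property_P_def
proof (intro allI impI)
  fix d n :: nat and \<theta> :: "nat \<Rightarrow> real" and v S \<delta> and \<mu> :: "(nat \<Rightarrow> real) measure"
  assume "1 \<le> d" "1 \<le> n" "0 < v" "psd d S" "trace_d d S = real d"
    and \<delta>: "0 < \<delta>" "\<delta> < (1::real)" and "is_mvn d \<theta> (\<lambda>i j. v * S i j) \<mu>"
  then interpret gaussian_samples d n \<theta> v S \<mu> by unfold_locales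
  have "1 - \<delta> \<le> prob {X \<in> space (iid_samples n \<mu>). nsq_error X \<le> g_fun 4 \<delta>}"
    using exp_moment_tail[OF nsq_error_measurable integrable_exp_nsq_error expectation_exp_nsq_error \<delta>(1)]
    by (intro prob_compl_ge) (measurable, simp add: not_le)
  also have "(\<lambda>X. nsq_error X \<le> g_fun 4 \<delta>) =
    (\<lambda>X. (dist_d d (emp_mean n X) \<theta>)\<^sup>2 \<le> 4 * ln (exp 1 / \<delta>) * (real d * v / real n))"
    using d n v by (simp add: nsq_error_def g_fun_def field_simps)
  finally show "1 - \<delta> \<le> \<P>(X in iid_samples n \<mu>.
      (dist_d d (emp_mean n X) \<theta>)\<^sup>2 \<le> 4 * ln (exp 1 / \<delta>) * (real d * v / real n))" .
qed

section \<open>The two-sample estimator\<close>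

lemma dist_d_nonneg: "0 \<le> dist_d d x y"
  by (simp add: dist_d_def)

lemma dist_d_commute: "dist_d d x y = dist_d d y x"
  by (simp add: dist_d_def L2_set_def power2_commute)

lemma dist_d_triangle: "dist_d d x z \<le> dist_d d x y + dist_d d y z"
  using L2_set_triangle_ineq[of "\<lambda>i. x i - y i" "\<lambda>i. y i - z i" "{..<d}"]
  by (simp add: dist_d_def)

text \<open>The selection threshold uses level \<open>\<delta>\<close>, while the tail bounds of the
  two means use \<open>\<delta> / 2\<close>. Passing between them costs at most a factor 2, since
  \<open>ln 2 \<le> 1\<close> and \<open>ln \<delta> < 0\<close>.\<close>

lemma g_fun_half:
  assumes "0 < \<delta>" "\<delta> < 1"
  shows "g_fun 4 (\<delta> / 2) = 4 * (1 + ln (2 / \<delta>))" "g_fun 4 (\<delta> / 2) \<le> 2 * g_fun 4 \<delta>" "1 \<le> g_fun 4 (\<delta> / 2)" "g_fun 4 \<delta> \<le> g_fun 4 (\<delta> / 2)"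
proof -
  have ln: "ln \<delta> < 0" "ln 2 \<le> (1::real)" "0 < ln (2::real)"
    using assms ln_2_less_1 by auto
  have eqs: "g_fun 4 (\<delta> / 2) = 4 + 4 * ln 2 - 4 * ln \<delta>" "g_fun 4 \<delta> = 4 - 4 * ln \<delta>"
    "ln (2 / \<delta>) = ln 2 - ln \<delta>"
    using assms by (simp_all add: g_fun_def ln_div ln_mult)
  show "g_fun 4 (\<delta> / 2) = 4 * (1 + ln (2 / \<delta>))" unfolding eqs by simp
  show "g_fun 4 (\<delta> / 2) \<le> 2 * g_fun 4 \<delta>" unfolding eqs using ln by argo
  show "1 \<le> g_fun 4 (\<delta> / 2)" unfolding eqs using ln by argo
  show "g_fun 4 \<delta> \<le> g_fun 4 (\<delta> / 2)" unfolding eqs using ln by argo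
qed

text \<open>The reals stand for distances: \<open>a\<close> and \<open>b\<close> from each empirical
  mean to its own centre, \<open>e\<close> from the second mean to the first centre,
  \<open>q\<close> between the centres, and \<open>t\<close> between the means. A large
  \<open>t\<close> forces a bias \<open>q\<close> comparable to \<open>sqrt (G * s0)\<close>, so the
  first mean is good enough; a small \<open>t\<close> keeps the second mean near the first. The
  factor 216 is \<open>8 / \<nu>\<close> for \<open>\<nu> = 1 / 27\<close>.\<close>

lemma selection_error_bound:
  fixes a b e q t s0 s1 g G :: real
  assumes nonneg: "0 \<le> a" "0 \<le> b" "0 \<le> e" "0 \<le> q" "0 \<le> t" "0 \<le> s1"
    and s: "s1 \<le> s0" and G: "1 \<le> G" "G \<le> 2 * g" and gG: "g \<le> G"
    and good: "a\<^sup>2 \<le> G * s0" "b\<^sup>2 \<le> G * s1"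
    and tri: "t \<le> a + q + b" "e \<le> b + q" "e \<le> t + a"
  shows "(if 10 * g * s0 \<le> t\<^sup>2 then a else e)\<^sup>2 \<le> 216 * G * min (q\<^sup>2 + s1 / 2) (s0 / 2)"
proof -
  define r where "r = sqrt (G * s0)"
  have r2: "r\<^sup>2 = G * s0" and r: "0 \<le> r"
    using G s nonneg by (auto simp: r_def)
  have Gs: "0 \<le> G * s1" "G * s1 \<le> G * s0" "q\<^sup>2 \<le> G * q\<^sup>2"
    using G(1) nonneg mult_left_mono[OF s, of G] mult_right_mono[OF G(1), of "q\<^sup>2"] by auto
  have ar: "a \<le> r" by (rule power2_le_imp_le) (use good(1) r r2 in simp_all)
  have br: "b \<le> r" by (rule power2_le_imp_le) (use good(2) Gs r r2 in simp_all)
  have gs: "5 * r\<^sup>2 \<le> 10 * g * s0"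
    using mult_right_mono[OF G(2), of s0] s nonneg r2 by simp
  show ?thesis
  proof (cases "10 * g * s0 \<le> t\<^sup>2")
    case True
    \<comment> \<open>The number 11/5 is a rational below \<open>sqrt 5\<close> but above 2: the
      errors \<open>a\<close> and \<open>b\<close> take at most \<open>2 * r\<close> of
      \<open>t\<close>, and the remaining \<open>r / 5\<close> must come from
      \<open>q\<close>.\<close>
    have "(11 / 5 * r)\<^sup>2 \<le> 5 * r\<^sup>2" by (simp add: power_mult_distrib power2_eq_square)
    then have "(11 / 5 * r)\<^sup>2 \<le> t\<^sup>2" using gs True by linarith
    then have "11 / 5 * r \<le> t" using nonneg(5) by (rule power2_le_imp_le)
    then have "r \<le> 5 * q" using tri(1) ar br by simp
    then have "r\<^sup>2 \<le> 25 * q\<^sup>2" using power_mono[OF _ r, of "5 * q" 2] by (simp add: power_mult_distrib)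
    moreover have "0 \<le> q\<^sup>2" by simp
    \<comment> \<open>The chain is \<open>a\<^sup>2 \<le> r\<^sup>2 \<le> 25 * q\<^sup>2 \<le> 25 *
      G * q\<^sup>2\<close>; the last step uses \<open>1 \<le> G\<close>.\<close>
    ultimately have "a\<^sup>2 \<le> 216 * G * (q\<^sup>2 + s1 / 2)"
      using good(1) r2 Gs unfolding distrib_left by (simp add: mult.assoc)
    moreover have "a\<^sup>2 \<le> 216 * G * (s0 / 2)"
      using good(1) Gs by simp
    ultimately show ?thesis using True by (simp add: min_def)
  next
    case False
    have e1: "e\<^sup>2 \<le> 2 * b\<^sup>2 + 2 * q\<^sup>2"
      using power_mono[OF tri(2) nonneg(3), of 2] sum_squares_bound[of b q] by (simp add: power2_sum)
    have e2: "e\<^sup>2 \<le> 2 * t\<^sup>2 + 2 * a\<^sup>2"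
      using power_mono[OF tri(3) nonneg(3), of 2] sum_squares_bound[of t a] by (simp add: power2_sum)
    have "e\<^sup>2 \<le> 216 * G * (q\<^sup>2 + s1 / 2)"
      using e1 good(2) Gs order_trans[OF zero_le_power2[of q] Gs(3)] unfolding distrib_left by (simp add: mult.assoc)
    \<comment> \<open>The failed test gives
      \<open>t\<^sup>2 < 10 * g * s0 \<le> 10 * G * s0\<close>, hence
      \<open>e\<^sup>2 \<le> 22 * G * s0\<close>, below the allowed
      \<open>108 * G * s0\<close>.\<close>
    moreover have "e\<^sup>2 \<le> 216 * G * (s0 / 2)"
      using e2 good(1) Gs False mult_right_mono[OF gG, of s0] s nonneg by simp
    ultimately show ?thesis using False by (simp add: min_def)
  qed
qed

text \<open>Off the good event the error is controlled by \<open>2 A \<le> m A\<^sup>2 + 1 / m\<close>: the event has probability at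
  most \<open>m\<^sup>2\<close>, so both terms contribute \<open>O(m)\<close>.\<close>

lemma (in prob_space) expectation_off_event_bound:
  fixes A B H :: "'a \<Rightarrow> real"
  assumes [measurable]: "A \<in> borel_measurable M" "B \<in> borel_measurable M" "H \<in> borel_measurable M"
    and nonneg: "\<And>x. 0 \<le> A x" "\<And>x. 0 \<le> B x" "\<And>x. 0 \<le> H x" "0 \<le> s0" "0 \<le> s1" "0 \<le> q2" "0 \<le> K"
    and A: "integrable M (\<lambda>x. exp (A x / 4))" "expectation (\<lambda>x. exp (A x / 4)) \<le> sqrt 2"
    and B: "integrable M (\<lambda>x. exp (B x / 4))" "expectation (\<lambda>x. exp (B x / 4)) \<le> sqrt 2"
    and m: "0 < m" and bad: "prob {x \<in> space M. \<not> (A x \<le> G \<and> B x \<le> G)} \<le> m\<^sup>2"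
    and H_good: "\<And>x. A x \<le> G \<Longrightarrow> B x \<le> G \<Longrightarrow> H x \<le> K"
    and H_bad: "\<And>x. H x \<le> A x * s0 + 2 * (B x * s1) + 2 * q2"
  shows "integrable M H" "expectation H \<le> K + 25 * (m * s0) + 50 * (m * s1) + 2 * m\<^sup>2 * q2"
proof -
  define E where "E = {x \<in> space M. \<not> (A x \<le> G \<and> B x \<le> G)}"
  have [measurable]: "E \<in> sets M" unfolding E_def by measurable
  \<comment> \<open>\<open>L\<close> collects the constants left on the bad event after splitting
    \<open>A\<close> and \<open>B\<close>. In \<open>F\<close> the exponential terms are charged on
    the whole space, so their unconditional expectations suffice.\<close>
  define L where "L = s0 / (2 * m) + s1 / m + 2 * q2"
  define F where "F = (\<lambda>x. K + 16 * m * s0 * exp (A x / 4) + 32 * m * s1 * exp (B x / 4) + indicat_real E x * L)"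
  have sq: "y \<le> 16 * m * exp (y / 4) + 1 / (2 * m)" if "0 \<le> y" for y
  proof -
    \<comment> \<open>The square from the splitting is traded for an exponential, because only
      exponential moments are at hand.\<close>
    have "(y / 4)\<^sup>2 / 2 \<le> exp (y / 4)"
      using exp_lower_Taylor_quadratic[of "y / 4"] that by simp
    then have "m * y\<^sup>2 / 2 \<le> 16 * m * exp (y / 4)"
      using m by (simp add: power_divide)
    moreover have "y \<le> m * y\<^sup>2 / 2 + 1 / (2 * m)"
    proof -
      have "0 \<le> (m * y - 1)\<^sup>2 / (2 * m)" using m by simp
      also have "\<dots> = m * y\<^sup>2 / 2 + 1 / (2 * m) - y"
        using m by (simp add: field_simps power2_eq_square)
      finally show ?thesis by simp
    qed
    ultimately show ?thesis by simp
  qed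
  have HF: "H x \<le> F x" if "x \<in> space M" for x
  proof (cases "x \<in> E")
    case True
    have "A x * s0 \<le> (16 * m * exp (A x / 4) + 1 / (2 * m)) * s0"
      "B x * s1 \<le> (16 * m * exp (B x / 4) + 1 / (2 * m)) * s1"
      by (intro mult_right_mono sq nonneg)+
    then have "A x * s0 + 2 * (B x * s1) + 2 * q2 \<le> F x"
      using True nonneg(7) by (simp add: F_def L_def algebra_simps)
    then show ?thesis using H_bad[of x] by linarith
  next
    case False
    then have "H x \<le> K" using that by (intro H_good) (auto simp: E_def)
    also have "\<dots> \<le> F x" using False nonneg m by (simp add: F_def)
    finally show ?thesis .
  qed
  have intE: "integrable M (\<lambda>x. indicat_real E x * L)"
    by (intro integrable_mult_left integrable_real_indicator) (auto simp: emeasure_eq_measure)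
  have intF: "integrable M F"
    unfolding F_def by (intro Bochner_Integration.integrable_add integrable_mult_right A B intE) auto
  show intH: "integrable M H"
  proof (rule Bochner_Integration.integrable_bound[OF intF])
    show "AE x in M. norm (H x) \<le> norm (F x)"
      using HF nonneg(3) by (intro AE_I2) (auto simp: abs_of_nonneg intro: order_trans[OF _ abs_ge_self])
  qed measurable
  have "expectation H \<le> expectation F"
    by (intro integral_mono intH intF HF)
  also have "\<dots> = K + 16 * m * s0 * expectation (\<lambda>x. exp (A x / 4))
      + 32 * m * s1 * expectation (\<lambda>x. exp (B x / 4)) + prob E * L"
    unfolding F_def using A B intE by (simp add: prob_space)
  also have "\<dots> \<le> K + 16 * m * s0 * (3 / 2) + 32 * m * s1 * (3 / 2) + m\<^sup>2 * L"
  proof -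
    have "sqrt 2 \<le> 3 / 2" by (intro real_le_lsqrt) (auto simp: power2_eq_square)
    then show ?thesis
      using A(2) B(2) bad m nonneg
      by (intro add_mono mult_left_mono mult_right_mono) (auto simp: E_def L_def)
  qed
  \<comment> \<open>With \<open>sqrt 2\<close> replaced by 3/2, the coefficients of
    \<open>m * s0\<close> and \<open>m * s1\<close> are 24 + 1/2 and 48 + 1, rounded up to 25 and
    50.\<close>
  also have "m\<^sup>2 * L = m * s0 / 2 + m * s1 + 2 * m\<^sup>2 * q2"
    using m by (simp add: L_def field_simps power2_eq_square)
  finally show "expectation H \<le> K + 25 * (m * s0) + 50 * (m * s1) + 2 * m\<^sup>2 * q2"
    using mult_nonneg_nonneg[OF less_imp_le[OF m] nonneg(4)]
      mult_nonneg_nonneg[OF less_imp_le[OF m] nonneg(5)] by (simp add: mult_ac)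
qed

section \<open>The product space of the two samples\<close>

locale two_gaussian_samples =
  G0: gaussian_samples d n \<theta>0 v0 S0 \<mu>0 + G1: gaussian_samples d n \<theta>1 v1 S1 \<mu>1
  for d n \<theta>0 v0 S0 \<mu>0 \<theta>1 v1 S1 \<mu>1 +
  assumes v1_less: "v1 < v0"
begin

abbreviation M where "M \<equiv> iid_samples n \<mu>0 \<Otimes>\<^sub>M iid_samples n \<mu>1"

sublocale pair_prob_space "iid_samples n \<mu>0" "iid_samples n \<mu>1" ..

definition "A XY = G0.nsq_error (fst XY)"
definition "B XY = G1.nsq_error (snd XY)"
definition "s0 = real d * v0 / real n"
definition "s1 = real d * v1 / real n"
definition "q = dist_d d \<theta>1 \<theta>0"
text \<open>Each sample has size \<open>n\<close>, half of the total \<open>N\<close>, so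
  \<open>s0 / 2\<close> and \<open>s1 / 2\<close> are the quantities with denominator
  \<open>N\<close> in the theorem.\<close>

definition "R = min (q\<^sup>2 + s1 / 2) (s0 / 2)"

lemma s_pos: "0 < s1" "s1 < s0"
  using G0.d G0.n G1.v v1_less by (auto simp: s0_def s1_def divide_strict_right_mono)

lemma A_measurable [measurable]: "A \<in> borel_measurable M"
  unfolding A_def by measurable

lemma B_measurable [measurable]: "B \<in> borel_measurable M"
  unfolding B_def by measurable

text \<open>\<open>A\<close> factors through the first projection, whose law is the first marginal,
  so the one-sample moment bound carries over.\<close>

lemma integrable_exp_A: "integrable M (\<lambda>x. exp (A x / 4))"
  and expectation_exp_A: "expectation (\<lambda>x. exp (A x / 4)) \<le> sqrt 2"
proof -
  let ?f = "\<lambda>X. exp (G0.nsq_error X / 4)"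
  have *: "distr M (iid_samples n \<mu>0) fst = iid_samples n \<mu>0"
    by (rule G1.distr_pair_fst)
  show "integrable M (\<lambda>x. exp (A x / 4))"
    using G0.integrable_exp_nsq_error
    unfolding A_def by (subst integrable_distr_eq[symmetric, of fst M "iid_samples n \<mu>0" ?f]) (auto simp: *)
  have "expectation (\<lambda>x. exp (A x / 4)) = G0.expectation ?f"
    unfolding A_def by (subst integral_distr[symmetric, of fst M "iid_samples n \<mu>0" ?f]) (auto simp: *)
  then show "expectation (\<lambda>x. exp (A x / 4)) \<le> sqrt 2"
    using G0.expectation_exp_nsq_error by simp
qed

lemma integrable_exp_B: "integrable M (\<lambda>x. exp (B x / 4))"
  and expectation_exp_B: "expectation (\<lambda>x. exp (B x / 4)) \<le> sqrt 2"
proof -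
  let ?f = "\<lambda>X. exp (G1.nsq_error X / 4)"
  have *: "distr M (iid_samples n \<mu>1) snd = iid_samples n \<mu>1"
    by (rule distr_pair_snd) unfold_locales
  show "integrable M (\<lambda>x. exp (B x / 4))"
    using G1.integrable_exp_nsq_error
    unfolding B_def by (subst integrable_distr_eq[symmetric, of snd M "iid_samples n \<mu>1" ?f]) (auto simp: *)
  have "expectation (\<lambda>x. exp (B x / 4)) = G1.expectation ?f"
    unfolding B_def by (subst integral_distr[symmetric, of snd M "iid_samples n \<mu>1" ?f]) (auto simp: *)
  then show "expectation (\<lambda>x. exp (B x / 4)) \<le> sqrt 2"
    using G1.expectation_exp_nsq_error by simp
qed

text \<open>A union bound over two tails, each of level \<open>\<delta> / 2\<close>.\<close>

lemma bad_event:
  assumes "0 < \<delta>"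
  shows "prob {x \<in> space M. \<not> (A x \<le> g_fun 4 (\<delta> / 2) \<and> B x \<le> g_fun 4 (\<delta> / 2))} \<le> \<delta>"
proof -
  let ?G = "g_fun 4 (\<delta> / 2)"
  have "prob {x \<in> space M. \<not> (A x \<le> ?G \<and> B x \<le> ?G)} =
    prob ({x \<in> space M. ?G < A x} \<union> {x \<in> space M. ?G < B x})"
    by (intro arg_cong[where f=prob]) auto
  also have "\<dots> \<le> prob {x \<in> space M. ?G < A x} + prob {x \<in> space M. ?G < B x}"
    by (intro measure_Un_le) measurable
  also have "\<dots> \<le> \<delta> / 2 + \<delta> / 2"
    using assms by (intro add_mono exp_moment_tail integrable_exp_A expectation_exp_A
        integrable_exp_B expectation_exp_B) auto
  finally show ?thesis by simp
qed

section \<open>The squared error of the selected mean\<close>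

definition err :: "real \<Rightarrow> (nat \<Rightarrow> nat \<Rightarrow> real) \<times> (nat \<Rightarrow> nat \<Rightarrow> real) \<Rightarrow> real" where
  "err \<delta> XY = (dist_d d (theta_hat 4 d (2 * n) v0 \<delta> XY) \<theta>0)\<^sup>2"

lemma err_eq:
  "err \<delta> XY = (if 10 * g_fun 4 \<delta> * s0 \<le> (dist_d d (emp_mean n (fst XY)) (emp_mean n (snd XY)))\<^sup>2
     then dist_d d (emp_mean n (fst XY)) \<theta>0 else dist_d d (emp_mean n (snd XY)) \<theta>0)\<^sup>2"
  by (simp add: err_def theta_hat_def Let_def s0_def)

lemma err_measurable [measurable]: "err \<delta> \<in> borel_measurable M"
proof -
  have [measurable]: "(\<lambda>XY. dist_d d (emp_mean n (fst XY)) (emp_mean n (snd XY))) \<in> borel_measurable M"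
  proof -
    have "(\<lambda>XY. \<Sum>i<d. (emp_mean n (fst XY) i - emp_mean n (snd XY) i)\<^sup>2) \<in> borel_measurable M"
      by (intro borel_measurable_sum borel_measurable_power borel_measurable_diff
          measurable_compose[OF measurable_fst G0.emp_mean_measurable]
          measurable_compose[OF measurable_snd G1.emp_mean_measurable]) auto
    note [measurable] = this
    show ?thesis unfolding dist_d_def L2_set_def by measurable
  qed
  show ?thesis unfolding err_eq[abs_def] by measurable
qed

lemma err_good:
  assumes "0 < \<delta>" "\<delta> < 1" "A XY \<le> g_fun 4 (\<delta> / 2)" "B XY \<le> g_fun 4 (\<delta> / 2)"
  shows "err \<delta> XY \<le> 216 * g_fun 4 (\<delta> / 2) * R"
  unfolding err_eq R_def
proof (rule selection_error_bound[where b="dist_d d (emp_mean n (snd XY)) \<theta>1"])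
  let ?a = "emp_mean n (fst XY)" and ?b = "emp_mean n (snd XY)"
  show "(dist_d d ?a \<theta>0)\<^sup>2 \<le> g_fun 4 (\<delta> / 2) * s0"
    unfolding G0.dist_eq_nsq_error s0_def[symmetric]
    using assms s_pos by (intro mult_right_mono) (auto simp: A_def)
  show "(dist_d d ?b \<theta>1)\<^sup>2 \<le> g_fun 4 (\<delta> / 2) * s1"
    unfolding G1.dist_eq_nsq_error s1_def[symmetric]
    using assms s_pos by (intro mult_right_mono) (auto simp: B_def)
  show "dist_d d ?a ?b \<le> dist_d d ?a \<theta>0 + q + dist_d d ?b \<theta>1"
    using dist_d_triangle[of d ?a ?b \<theta>0] dist_d_triangle[of d \<theta>0 ?b \<theta>1]
    by (simp add: q_def dist_d_commute)
  show "dist_d d ?b \<theta>0 \<le> dist_d d ?b \<theta>1 + q"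
    unfolding q_def by (rule dist_d_triangle)
  show "dist_d d ?b \<theta>0 \<le> dist_d d ?a ?b + dist_d d ?a \<theta>0"
    using dist_d_triangle[of d ?b \<theta>0 ?a] by (simp add: dist_d_commute)
qed (use s_pos g_fun_half[OF assms(1,2)] in \<open>auto simp: dist_d_nonneg q_def\<close>)

text \<open>Adding the bounds for both possible selections covers every outcome; this crude estimate
  is what controls the error off the good event.\<close>

lemma err_le: "err \<delta> XY \<le> A XY * s0 + 2 * (B XY * s1) + 2 * q\<^sup>2"
proof -
  let ?a = "emp_mean n (fst XY)" and ?b = "emp_mean n (snd XY)"
  have "(dist_d d ?a \<theta>0)\<^sup>2 = A XY * s0" and B: "(dist_d d ?b \<theta>1)\<^sup>2 = B XY * s1"
    by (simp_all add: G0.dist_eq_nsq_error G1.dist_eq_nsq_error A_def B_def s0_def s1_def)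
  moreover have "(dist_d d ?b \<theta>0)\<^sup>2 \<le> 2 * (B XY * s1) + 2 * q\<^sup>2"
  proof -
    have "(dist_d d ?b \<theta>0)\<^sup>2 \<le> (dist_d d ?b \<theta>1 + q)\<^sup>2"
      unfolding q_def by (intro power_mono dist_d_triangle dist_d_nonneg)
    also have "\<dots> \<le> 2 * (dist_d d ?b \<theta>1)\<^sup>2 + 2 * q\<^sup>2"
      using sum_squares_bound[of "dist_d d ?b \<theta>1" q] by (simp add: power2_sum)
    finally show ?thesis by (simp add: B)
  qed
  moreover have "0 \<le> A XY * s0" "0 \<le> B XY * s1"
    using s_pos by (auto simp: A_def B_def G0.nsq_error_nonneg G1.nsq_error_nonneg)
  ultimately show ?thesis
    unfolding err_eq using zero_le_power2[of q] by (simp del: zero_le_power2)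
qed

lemma err_high_probability:
  assumes "0 < \<delta>" "\<delta> < 1"
  shows "1 - \<delta> \<le> prob {XY \<in> space M. err \<delta> XY \<le> 216 * g_fun 4 (\<delta> / 2) * R}"
proof -
  have "1 - \<delta> \<le> prob {x \<in> space M. A x \<le> g_fun 4 (\<delta> / 2) \<and> B x \<le> g_fun 4 (\<delta> / 2)}"
    using bad_event[OF assms(1)] by (intro prob_compl_ge) measurable
  also have "\<dots> \<le> prob {XY \<in> space M. err \<delta> XY \<le> 216 * g_fun 4 (\<delta> / 2) * R}"
    by (intro finite_measure_mono) (auto intro: err_good[OF assms])
  finally show ?thesis .
qed

lemma err_expectation:
  assumes C: "0 < C" "q\<^sup>2 \<le> 4 * C\<^sup>2"
  defines "\<delta> \<equiv> delta_star d (2 * n) v0 v1 C"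
  shows "integrable M (err \<delta>)" "expectation (err \<delta>) \<le> 3024 * ln (2 / \<delta>) * R"
proof -
  \<comment> \<open>\<open>m\<close> is the square root of \<open>\<delta>\<close>. Its first entry
    gives \<open>m * s0 \<le> s1\<close>, the second keeps \<open>\<delta>\<close> at most 1/16, and
    the third makes \<open>m * q\<^sup>2\<close> at most \<open>s0 / 4\<close>.\<close>
  define m where "m = min (v1 / (v0 + v1)) (min (1 / 4) (real d * v0 / (8 * C\<^sup>2 * real (2 * n))))"
  have \<delta>: "\<delta> = m\<^sup>2" by (simp add: \<delta>_def delta_star_def m_def)
  have pos: "0 < v0" "0 < v1" "0 < real d" "0 < real n" "0 < C"
    using G0.v G1.v G0.d G0.n C by auto
  have m0: "0 < m" using pos by (simp add: m_def)
  have m1: "m \<le> 1 / 4" unfolding m_def by (intro min.coboundedI2 min.cobounded1)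
  have m2: "m\<^sup>2 \<le> 1 / 16" using power_mono[OF m1, of 2] m0 by (simp add: power2_eq_square)
  have \<delta>01: "0 < \<delta>" "\<delta> < 1" using m0 m2 by (auto simp: \<delta>)
  have ms0: "m * s0 \<le> 2 * R"
  proof -
    have "m * v0 \<le> v1 / (v0 + v1) * (v0 + v1)"
      using pos by (intro mult_mono) (auto simp: m_def)
    then have "m * v0 \<le> v1" using pos by simp
    then have "real d * (m * v0) / real n \<le> real d * v1 / real n"
      by (intro divide_right_mono mult_left_mono) auto
    then have "m * s0 \<le> s1" by (simp add: s0_def s1_def mult_ac)
    moreover have "m * s0 \<le> 1 / 4 * s0"
      using m1 s_pos by (intro mult_right_mono) auto
    ultimately show ?thesis using s_pos add_increasing[OF zero_le_power2[of q], of "m * s0 / 2" "s1 / 2"]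
      by (simp add: R_def min_def)
  qed
  have ms1: "m * s1 \<le> 2 * R"
    using mult_left_mono[OF less_imp_le[OF s_pos(2)] less_imp_le[OF m0]] ms0 by (rule order_trans)
  have mq: "m\<^sup>2 * q\<^sup>2 \<le> R"
  proof -
    have "m\<^sup>2 * q\<^sup>2 \<le> m * q\<^sup>2"
      using m0 m1 by (intro mult_right_mono) (auto simp: power2_eq_square intro: mult_left_le)
    moreover have "m * q\<^sup>2 \<le> q\<^sup>2"
      using m1 by (simp add: mult_left_le_one_le m0 less_imp_le)
    moreover have "m * q\<^sup>2 \<le> real d * v0 / (8 * C\<^sup>2 * real (2 * n)) * (4 * C\<^sup>2)"
      using C m0 by (intro mult_mono) (auto simp: m_def)
    moreover have "\<dots> = s0 / 4"
      using pos by (simp add: s0_def field_simps)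
    ultimately show ?thesis using s_pos by (simp add: R_def)
  qed
  have R: "0 \<le> R" using s_pos by (simp add: R_def)
  let ?G = "g_fun 4 (\<delta> / 2)"
  have K: "0 \<le> 216 * ?G * R" using g_fun_half[OF \<delta>01] R by simp
  have bad: "prob {x \<in> space M. \<not> (A x \<le> ?G \<and> B x \<le> ?G)} \<le> m\<^sup>2"
    unfolding \<delta>[symmetric] by (rule bad_event[OF \<delta>01(1)])
  note * = expectation_off_event_bound[OF A_measurable B_measurable err_measurable _ _ _ _ _ _ K
      integrable_exp_A expectation_exp_A integrable_exp_B expectation_exp_B m0
      bad err_good[OF \<delta>01] err_le]
  show "integrable M (err \<delta>)"
    by (rule *) (use s_pos in \<open>auto simp: A_def B_def err_def G0.nsq_error_nonneg G1.nsq_error_nonneg\<close>)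
  have "expectation (err \<delta>) \<le> 216 * ?G * R + 25 * (m * s0) + 50 * (m * s1) + 2 * m\<^sup>2 * q\<^sup>2"
    by (rule *) (use s_pos in \<open>auto simp: A_def B_def err_def G0.nsq_error_nonneg G1.nsq_error_nonneg\<close>)
  \<comment> \<open>Here 864 is 216 * 4, and 152 is 25 * 2 + 50 * 2 + 2 from the three bounds in
    terms of \<open>R\<close>.\<close>
  also have "\<dots> \<le> 864 * (1 + ln (2 / \<delta>)) * R + 152 * R"
    using ms0 ms1 mq by (simp add: g_fun_half(1)[OF \<delta>01])
  also have "\<dots> = 864 * (ln (2 / \<delta>) * R) + 1016 * R"
    by (simp add: algebra_simps)
  also have "\<dots> \<le> 3024 * (ln (2 / \<delta>) * R)"
  proof -
    \<comment> \<open>The logarithm is at least 1, so the remaining \<open>1016 * R\<close> fits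
      into the spare \<open>2160 * ln (2 / \<delta>) * R\<close>.\<close>
    have "3 \<le> 2 / \<delta>" using \<delta>01 m2 by (simp add: \<delta> field_simps)
    then have "exp 1 \<le> 2 / \<delta>" by (rule order_trans[OF exp_le])
    then have "1 \<le> ln (2 / \<delta>)" using \<delta>01 by (simp add: ln_ge_iff)
    from mult_right_mono[OF this R] show ?thesis using R by argo
  qed
  finally show "expectation (err \<delta>) \<le> 3024 * ln (2 / \<delta>) * R"
    by (simp add: mult.assoc)
qed

end

theorem theorem1:
  "\<exists>c \<nu> :: real. 1 < c \<and> 1 / 27 \<le> \<nu> \<and> \<nu> < 1 \<and> property_P c \<and>
    (\<forall>(d::nat) (N::nat) (\<theta>0 :: nat \<Rightarrow> real) (\<theta>1 :: nat \<Rightarrow> real) (v0::real) (v1::real)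
       (S0 :: nat \<Rightarrow> nat \<Rightarrow> real) (S1 :: nat \<Rightarrow> nat \<Rightarrow> real)
       (\<mu>0 :: (nat \<Rightarrow> real) measure) (\<mu>1 :: (nat \<Rightarrow> real) measure).
       1 \<le> d \<longrightarrow> 2 \<le> N \<longrightarrow> even N \<longrightarrow> 0 < v1 \<longrightarrow> v1 < v0 \<longrightarrow>
       psd d S0 \<longrightarrow> trace_d d S0 = real d \<longrightarrow> psd d S1 \<longrightarrow> trace_d d S1 = real d \<longrightarrow>
       is_mvn d \<theta>0 (\<lambda>i j. v0 * S0 i j) \<mu>0 \<longrightarrow> is_mvn d \<theta>1 (\<lambda>i j. v1 * S1 i j) \<mu>1 \<longrightarrow>
       (let M = iid_samples (N div 2) \<mu>0 \<Otimes>\<^sub>M iid_samples (N div 2) \<mu>1;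
            Q1 = dist_d d \<theta>1 \<theta>0;
            R = min (Q1\<^sup>2 + real d * v1 / real N) (real d * v0 / real N)
        in
          (\<forall>\<delta>::real. 0 < \<delta> \<longrightarrow> \<delta> < 1 \<longrightarrow>
             \<P>(XY in M. (dist_d d (theta_hat c d N v0 \<delta> XY) \<theta>0)\<^sup>2 \<le> 8 * g_fun c (\<delta> / 2) / \<nu> * R)
               \<ge> 1 - \<delta>) \<and>
          (\<forall>C::real. 0 < C \<longrightarrow> Q1\<^sup>2 \<le> 4 * C\<^sup>2 \<longrightarrow>
             integrable M (\<lambda>XY. (dist_d d (theta_hat c d N v0 (delta_star d N v0 v1 C) XY) \<theta>0)\<^sup>2) \<and>
             (\<integral>XY. (dist_d d (theta_hat c d N v0 (delta_star d N v0 v1 C) XY) \<theta>0)\<^sup>2 \<partial>M)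
               \<le> 28 * c / \<nu> * ln (2 / delta_star d N v0 v1 C) * R)))"
\<comment> \<open>With the smallest admissible \<open>\<nu>\<close>, the factor
  \<open>8 / \<nu>\<close> is 216 and \<open>28 * c / \<nu>\<close> is 3024, matching the locale
  bounds.\<close>
proof (rule exI[of _ 4], rule exI[of _ "1 / 27"], intro conjI property_P_4 allI impI)
  fix d N :: nat and \<theta>0 \<theta>1 :: "nat \<Rightarrow> real" and v0 v1 :: real and S0 S1 :: "nat \<Rightarrow> nat \<Rightarrow> real"
    and \<mu>0 \<mu>1 :: "(nat \<Rightarrow> real) measure"
  assume asm: "1 \<le> d" "2 \<le> N" "even N" "0 < v1" "v1 < v0"
    "psd d S0" "trace_d d S0 = real d" "psd d S1" "trace_d d S1 = real d"
    "is_mvn d \<theta>0 (\<lambda>i j. v0 * S0 i j) \<mu>0" "is_mvn d \<theta>1 (\<lambda>i j. v1 * S1 i j) \<mu>1"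
  \<comment> \<open>Evenness makes \<open>N = 2 * n\<close> exact, and \<open>2 \<le> N\<close>
    gives \<open>1 \<le> n\<close>.\<close>
  define n where "n = N div 2"
  have N: "N = 2 * n" "N div 2 = n" and n: "1 \<le> n"
    using asm by (auto simp: n_def)
  interpret two_gaussian_samples d n \<theta>0 v0 S0 \<mu>0 \<theta>1 v1 S1 \<mu>1
    using asm n by unfold_locales auto
  have R: "min ((dist_d d \<theta>1 \<theta>0)\<^sup>2 + real d * v1 / real N) (real d * v0 / real N) = R"
    by (simp add: R_def q_def s0_def s1_def N(1) mult.commute)
  show "let M = iid_samples (N div 2) \<mu>0 \<Otimes>\<^sub>M iid_samples (N div 2) \<mu>1;
            Q1 = dist_d d \<theta>1 \<theta>0;
            R = min (Q1\<^sup>2 + real d * v1 / real N) (real d * v0 / real N)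
        in
          (\<forall>\<delta>::real. 0 < \<delta> \<longrightarrow> \<delta> < 1 \<longrightarrow>
             \<P>(XY in M. (dist_d d (theta_hat 4 d N v0 \<delta> XY) \<theta>0)\<^sup>2 \<le> 8 * g_fun 4 (\<delta> / 2) / (1 / 27) * R)
               \<ge> 1 - \<delta>) \<and>
          (\<forall>C::real. 0 < C \<longrightarrow> Q1\<^sup>2 \<le> 4 * C\<^sup>2 \<longrightarrow>
             integrable M (\<lambda>XY. (dist_d d (theta_hat 4 d N v0 (delta_star d N v0 v1 C) XY) \<theta>0)\<^sup>2) \<and>
             (\<integral>XY. (dist_d d (theta_hat 4 d N v0 (delta_star d N v0 v1 C) XY) \<theta>0)\<^sup>2 \<partial>M)
               \<le> 28 * 4 / (1 / 27) * ln (2 / delta_star d N v0 v1 C) * R)"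
    unfolding Let_def R N(2)
  proof (intro conjI allI impI)
    fix \<delta> :: real assume "0 < \<delta>" "\<delta> < 1"
    from err_high_probability[OF this] show "1 - \<delta> \<le>
      prob {XY \<in> space M. (dist_d d (theta_hat 4 d N v0 \<delta> XY) \<theta>0)\<^sup>2 \<le> 8 * g_fun 4 (\<delta> / 2) / (1 / 27) * R}"
      by (simp add: err_def N(1))
  next
    fix C :: real assume "0 < C" "(dist_d d \<theta>1 \<theta>0)\<^sup>2 \<le> 4 * C\<^sup>2"
    note * = err_expectation[OF this[folded q_def], folded N(1)]
    show "integrable M (\<lambda>XY. (dist_d d (theta_hat 4 d N v0 (delta_star d N v0 v1 C) XY) \<theta>0)\<^sup>2)"
      using *(1) by (simp add: err_def[abs_def] N(1))
    show "expectation (\<lambda>XY. (dist_d d (theta_hat 4 d N v0 (delta_star d N v0 v1 C) XY) \<theta>0)\<^sup>2)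
        \<le> 28 * 4 / (1 / 27) * ln (2 / delta_star d N v0 v1 C) * R"
      using *(2) by (simp add: err_def[abs_def] N(1))
  qed
qed auto

end
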